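(* $\mathrm{CRT}_{\mathrm I}(3)=\mathrm{CRT}_{\mathrm W}(3)=\mathrm{RT}(3)=\tfrac{7}{4}$, where $\mathrm{CRT}_{\mathrm I}(k)$, $\mathrm{CRT}_{\mathrm W}(k)$ and $\mathrm{RT}(k)$ denote the intermediate circular repetition threshold, the weak circular repetition threshold and the repetition threshold on $k$ letters, respectively.
   Context: A word $w=w_1\cdots w_n$ has period $p\ge 1$ if $w_{i+p}=w_i$ for all $1\le i\le n-p$ (so $n$ is always a period). The exponent of a nonempty word is its length divided by its minimal period. Two words $x,y$ are conjugates if $x=uv$ and $y=vu$ for some words $u,v$. For a word $w$, the circular word $(w)$ is the set of all conjugates of $w$; its length is $|w|$. A word is a factor of $(w)$ if it is a (contiguous) factor of some conjugate of $w$. A (linear or circular) word is $\beta$-free if it has no factor of exponent greater than or equal to $\beta$. A word is $k$-ary if it is over an alphabet of $k$ letters. Define $$\mathrm{RT}(k)=\inf\{\beta : \text{there are arbitrarily long } k\text{-ary } \beta\text{-free (linear) words}\},$$ $$\mathrm{CRT}_{\mathrm W}(k)=\inf\{\beta : \text{there are arbitrarily long } k\text{-ary } \beta\text{-free circular words}\},$$ $$\mathrm{CRT}_{\mathrm I}(k)=\inf\{\beta : \text{there are } k\text{-ary } \beta\text{-free circular words of every sufficiently large length}\}.$$ *)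

theory Defs
  imports "HOL-Library.Sublist" "HOL-Library.Extended_Real"
begin

text \<open>Words are lists, indexed from 0; "contiguous factor" is the relation \<open>sublist\<close>
  of theory Sublist.\<close>

definition has_period :: "'a list \<Rightarrow> nat \<Rightarrow> bool" where
  "has_period w p \<longleftrightarrow> 1 \<le> p \<and> (\<forall>i. i + p < length w \<longrightarrow> w ! (i + p) = w ! i)"

definition min_period :: "'a list \<Rightarrow> nat" where
  "min_period w = (LEAST p. has_period w p)"

definition exponent :: "'a list \<Rightarrow> real" where
  "exponent w = real (length w) / real (min_period w)"

definition conjugate :: "'a list \<Rightarrow> 'a list \<Rightarrow> bool" where
  "conjugate x y \<longleftrightarrow> (\<exists>u v. x = u @ v \<and> y = v @ u)"

definition circular_word :: "'a list \<Rightarrow> 'a list set" where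
  "circular_word w = {x. conjugate w x}"

definition circular_factor :: "'a list \<Rightarrow> 'a list set \<Rightarrow> bool" where
  "circular_factor u C \<longleftrightarrow> (\<exists>x\<in>C. sublist u x)"

definition free_word :: "real \<Rightarrow> 'a list \<Rightarrow> bool" where
  "free_word \<beta> w \<longleftrightarrow> \<not> (\<exists>u. u \<noteq> [] \<and> sublist u w \<and> exponent u \<ge> \<beta>)"

definition free_circular :: "real \<Rightarrow> 'a list set \<Rightarrow> bool" where
  "free_circular \<beta> C \<longleftrightarrow> \<not> (\<exists>u. u \<noteq> [] \<and> circular_factor u C \<and> exponent u \<ge> \<beta>)"

definition kary :: "nat \<Rightarrow> nat list \<Rightarrow> bool" where
  "kary k w \<longleftrightarrow> set w \<subseteq> {..<k}"

text \<open>The thresholds are infima of sets of real numbers, taken in the extended reals so that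
  the infimum of the empty set (as for \<open>k = 1\<close>) is \<open>\<infinity>\<close> rather than an unspecified real.\<close>

definition RT :: "nat \<Rightarrow> ereal" where
  "RT k = Inf (ereal ` {\<beta>. \<forall>n. \<exists>w. length w \<ge> n \<and> kary k w \<and> free_word \<beta> w})"

definition CRT_W :: "nat \<Rightarrow> ereal" where
  "CRT_W k = Inf (ereal `
     {\<beta>. \<forall>n. \<exists>w. length w \<ge> n \<and> kary k w \<and> free_circular \<beta> (circular_word w)})"

definition CRT_I :: "nat \<Rightarrow> ereal" where
  "CRT_I k = Inf (ereal `
     {\<beta>. \<exists>N. \<forall>n\<ge>N. \<exists>w. length w = n \<and> kary k w \<and> free_circular \<beta> (circular_word w)})"

end

theory Submission
  imports Defs
begin

text \<open>Backtracking shows that every ternary word of length 39 has a factor of exponent at least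
  \<open>7/4\<close>, which gives the lower bound.

  For the upper bound let \<open>d\<close> be the fixed point of Dejean's 19-uniform morphism. Distinct letters
  have images that differ in every position, and a factor of length 10 determines its position
  modulo 19; hence a repetition \<open>x y x\<close> in \<open>d\<close> with \<open>x\<close> of length at least 10 is contained in
  the image of one of the same exponent, and \<open>d\<close> has no factor of exponent greater than \<open>7/4\<close>.
  The words \<open>d\<close> and \<open>-d\<close> (negation modulo 3) have no common factor of length 18. Consider the
  circular word \<open>U y V t\<close>, where \<open>U\<close> is a long factor of \<open>d\<close>, \<open>V\<close> is a factor of a
  translate of \<open>-d\<close> of roughly the same length, and \<open>y\<close> (one letter) and \<open>t\<close> are connectors such
  that no window of length 18 that meets a connector occurs a second time. If a repetition has
  \<open>x\<close> of length at least 18, both occurrences of \<open>x\<close> lie in \<open>U\<close> or both lie in \<open>V\<close>, and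
  the repetition cannot run around the circle since that would make its period too long. The
  shorter repetitions that meet a connector are excluded by a finite check. Nineteen choices of \<open>t\<close> take
  care of the residues of the length modulo 19, and small shifts of the two ends of \<open>V\<close> make the
  letters at the junctions fit.\<close>

section \<open>Evaluating finite checks\<close>

text \<open>The auxiliary functions branch by matching on an evaluated Boolean: in a lazy conjunction or
  conditional the simplifier would normalize the remaining data again at every step.\<close>

fun agree :: "nat \<Rightarrow> 'a list \<Rightarrow> 'a list \<Rightarrow> bool"
  and agree_aux :: "bool \<Rightarrow> nat \<Rightarrow> 'a list \<Rightarrow> 'a list \<Rightarrow> bool" where
  "agree 0 xs ys = True"
| "agree (Suc l) (x # xs) (y # ys) = agree_aux (x = y) l xs ys"
| "agree (Suc l) (x # xs) [] = False"
| "agree (Suc l) [] ys = False"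
| "agree_aux True l xs ys = agree l xs ys"
| "agree_aux False l xs ys = False"

lemma agree_iff:
  "agree l xs ys \<longleftrightarrow> l \<le> length xs \<and> l \<le> length ys \<and> (\<forall>j<l. xs ! j = ys ! j)"
proof (induction l arbitrary: xs ys)
  case (Suc l)
  show ?case
  proof (cases xs; cases ys)
    fix x xs' y ys' assume "xs = x # xs'" "ys = y # ys'"
    then show ?thesis
      using Suc[of xs' ys'] by (cases "x = y") (auto simp: All_less_Suc2)
  qed auto
qed auto

fun norun :: "nat \<Rightarrow> 'a list \<Rightarrow> 'a list \<Rightarrow> bool"
  and norun_aux :: "bool \<Rightarrow> nat \<Rightarrow> 'a list \<Rightarrow> 'a list \<Rightarrow> bool" where
  "norun l (x # xs) (y # ys) = norun_aux (agree l (x # xs) (y # ys)) l xs ys"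
| "norun l [] ys = True"
| "norun l (x # xs) [] = True"
| "norun_aux True l xs ys = False"
| "norun_aux False l xs ys = norun l xs ys"

lemma norunD:
  "norun l xs ys \<Longrightarrow> 0 < l \<Longrightarrow> i + l \<le> length xs \<Longrightarrow> i + l \<le> length ys
    \<Longrightarrow> \<exists>j<l. xs ! (i + j) \<noteq> ys ! (i + j)"
proof (induction xs arbitrary: ys i)
  case (Cons x xs)
  then obtain y ys' where ys: "ys = y # ys'"
    by (cases ys) auto
  have *: "\<not> agree l (x # xs) (y # ys')" "norun l xs ys'"
    using Cons.prems(1) unfolding ys by (cases "agree l (x # xs) (y # ys')"; simp)+
  show ?case
  proof (cases i)
    case 0
    then show ?thesis using *(1) Cons.prems ys by (auto simp: agree_iff)
  next
    case (Suc k)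
    then show ?thesis using Cons.IH[OF *(2), of k] Cons.prems ys by auto
  qed
qed auto

text \<open>A factor \<open>x y x\<close> of exponent greater than \<open>7/4\<close>, where \<open>x\<close> has length \<open>l\<close> and
  \<open>x y\<close> has length \<open>p\<close>, starting at position \<open>i\<close>.\<close>

definition long_rep :: "(nat \<Rightarrow> 'a) \<Rightarrow> nat \<Rightarrow> nat \<Rightarrow> nat \<Rightarrow> bool" where
  "long_rep f i p l \<longleftrightarrow> 0 < p \<and> 3 * p < 4 * l \<and> (\<forall>j<l. f (i + j) = f (i + p + j))"

text \<open>\<open>3 * p div 4 + 1\<close> is the least \<open>l\<close> with
  \<open>3 * p < 4 * l\<close>; a repetition with longer \<open>x\<close> contains one with this
  \<open>x\<close>, so one run length per period is enough.\<close>

definition short_free :: "nat \<Rightarrow> 'a list \<Rightarrow> bool" where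
  "short_free P w = list_all (\<lambda>p. norun (3 * p div 4 + 1) w (drop p w)) [1..<P]"

lemma short_freeD:
  assumes "short_free P (map f [a..<b])" "a \<le> i" "i + p + (3 * p div 4 + 1) \<le> b" "p < P"
  shows "\<not> long_rep f i p l"
proof
  assume R: "long_rep f i p l"
  define k where "k = 3 * p div 4 + 1"
  have k: "k \<le> l" "0 < k" "0 < p" "i + p + k \<le> b"
    using R assms by (auto simp: long_rep_def k_def)
  have "norun k (map f [a..<b]) (drop p (map f [a..<b]))"
    using assms(1,4) k by (auto simp: short_free_def list_all_iff k_def)
  then have "\<exists>j<k. map f [a..<b] ! (i - a + j) \<noteq> drop p (map f [a..<b]) ! (i - a + j)"
    by (rule norunD) (use k assms(2) in auto)
  then obtain j where j: "j < k"
    "map f [a..<b] ! (i - a + j) \<noteq> drop p (map f [a..<b]) ! (i - a + j)"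
    by blast
  have "map f [a..<b] ! (i - a + j) = f (i + j)"
    using j(1) k assms(2) by (simp add: nth_append)
  moreover have "drop p (map f [a..<b]) ! (i - a + j) = f (i + p + j)"
    using j(1) k assms(2) by (simp add: add_ac)
  ultimately show False
    using R k j by (auto simp: long_rep_def)
qed

text \<open>Sets of ternary words; all letters from 2 on are identified.\<close>

datatype trie = Leaf | Node trie trie trie

fun insert_word :: "nat list \<Rightarrow> trie \<Rightarrow> trie" where
  "insert_word [] Leaf = Node Leaf Leaf Leaf"
| "insert_word [] (Node a b c) = Node a b c"
| "insert_word (0 # w) Leaf = Node (insert_word w Leaf) Leaf Leaf"
| "insert_word (Suc 0 # w) Leaf = Node Leaf (insert_word w Leaf) Leaf"
| "insert_word (Suc (Suc x) # w) Leaf = Node Leaf Leaf (insert_word w Leaf)"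
| "insert_word (0 # w) (Node a b c) = Node (insert_word w a) b c"
| "insert_word (Suc 0 # w) (Node a b c) = Node a (insert_word w b) c"
| "insert_word (Suc (Suc x) # w) (Node a b c) = Node a b (insert_word w c)"

fun has_word :: "nat list \<Rightarrow> trie \<Rightarrow> bool" where
  "has_word [] Leaf = False"
| "has_word [] (Node a b c) = True"
| "has_word (0 # w) Leaf = False"
| "has_word (Suc 0 # w) Leaf = False"
| "has_word (Suc (Suc x) # w) Leaf = False"
| "has_word (0 # w) (Node a b c) = has_word w a"
| "has_word (Suc 0 # w) (Node a b c) = has_word w b"
| "has_word (Suc (Suc x) # w) (Node a b c) = has_word w c"

lemma has_word_insert_same: "has_word w (insert_word w t)"
  by (induction w t rule: insert_word.induct) auto

lemma has_word_insert: "has_word v t \<Longrightarrow> has_word v (insert_word w t)"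
proof (induction v t arbitrary: w rule: has_word.induct)
  case (2 a b c)
  then show ?case by (cases "(w, Node a b c)" rule: insert_word.cases) auto
next
  case (6 v a b c)
  then show ?case by (cases "(w, Node a b c)" rule: insert_word.cases) auto
next
  case (7 v a b c)
  then show ?case by (cases "(w, Node a b c)" rule: insert_word.cases) auto
next
  case (8 x v a b c)
  then show ?case by (cases "(w, Node a b c)" rule: insert_word.cases) auto
qed auto

lemma has_word_fold_mono: "has_word v t \<Longrightarrow> has_word v (fold insert_word ws t)"
  by (induction ws arbitrary: t) (auto intro: has_word_insert)

lemma has_word_fold: "w \<in> set ws \<Longrightarrow> has_word w (fold insert_word ws t)"
  by (induction ws arbitrary: t) (auto intro: has_word_fold_mono has_word_insert_same)

fun fresh :: "trie \<Rightarrow> nat list list \<Rightarrow> bool"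
  and fresh_aux :: "bool \<Rightarrow> trie \<Rightarrow> nat list \<Rightarrow> nat list list \<Rightarrow> bool" where
  "fresh t [] = True"
| "fresh t (w # ws) = fresh_aux (has_word w t) t w ws"
| "fresh_aux True t w ws = False"
| "fresh_aux False t w ws = fresh (insert_word w t) ws"

lemma freshD: "fresh t ws \<Longrightarrow> distinct ws \<and> (\<forall>w\<in>set ws. \<not> has_word w t)"
proof (induction ws arbitrary: t)
  case (Cons w ws)
  then have "\<not> has_word w t" "fresh (insert_word w t) ws"
    by (cases "has_word w t"; simp)+
  with Cons.IH[OF this(2)] show ?case
    using has_word_insert_same has_word_insert by auto
qed auto

fun avoids :: "trie \<Rightarrow> nat list list \<Rightarrow> bool"
  and avoids_aux :: "bool \<Rightarrow> trie \<Rightarrow> nat list list \<Rightarrow> bool" where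
  "avoids t [] = True"
| "avoids t (w # ws) = avoids_aux (has_word w t) t ws"
| "avoids_aux True t ws = False"
| "avoids_aux False t ws = avoids t ws"

lemma avoidsD: "avoids t ws \<Longrightarrow> w \<in> set ws \<Longrightarrow> \<not> has_word w t"
proof (induction ws)
  case (Cons v ws)
  then have "\<not> has_word v t" "avoids t ws"
    by (cases "has_word v t"; simp)+
  with Cons show ?case by auto
qed auto

section \<open>Dejean's word\<close>

text \<open>The image of 0 under Dejean's morphism; those of 1 and 2 are its translates modulo 3. As
  it begins and ends with 0, each image begins and ends with its own letter.\<close>

definition H :: "nat list" where
  "H = [0, 1, 2, 0, 2, 1, 2, 0, 1, 2, 1, 0, 2, 1, 2, 0, 2, 1, 0]"

lemma H_less: "r < 19 \<Longrightarrow> H ! r < 3"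
proof -
  have "list_all (\<lambda>r. H ! r < 3) [0..<19]" by code_simp
  then show "r < 19 \<Longrightarrow> ?thesis" by (simp add: list_all_iff)
qed

lemma H_Suc: "r < 18 \<Longrightarrow> H ! r \<noteq> H ! Suc r"
proof -
  have "list_all (\<lambda>r. H ! r \<noteq> H ! Suc r) [0..<18]" by code_simp
  then show "r < 18 \<Longrightarrow> ?thesis" by (simp add: list_all_iff)
qed

lemma less_3_iff: "x < 3 \<longleftrightarrow> x = 0 \<or> x = 1 \<or> x = (2::nat)"
  by auto

lemma mod_3_cancel:
  assumes "x < 3" "y < 3" "(x + c) mod 3 = (y + c) mod (3::nat)"
  shows "x = y"
proof -
  have "(x + c mod 3) mod 3 = (y + c mod 3) mod 3"
    using assms(3) by (simp add: mod_simps)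
  moreover have "c mod 3 < 3" by simp
  ultimately show ?thesis using assms(1,2) unfolding less_3_iff by auto
qed

text \<open>The fixed point starting with 0: the sum modulo 3 of \<open>H\<close> over the base-19
  digits of \<open>n\<close>.\<close>

fun dejean :: "nat \<Rightarrow> nat" where
  "dejean n = (if n = 0 then 0 else (dejean (n div 19) + H ! (n mod 19)) mod 3)"

declare dejean.simps [simp del]

lemma length_H [simp]: "length H = 19"
  by (simp add: H_def)

lemma dejean_less: "dejean n < 3"
  by (subst dejean.simps) auto

lemma dejean_block: "r < 19 \<Longrightarrow> dejean (19 * k + r) = (dejean k + H ! r) mod 3"
proof (cases "k = 0 \<and> r = 0")
  case True
  then show ?thesis by (simp add: dejean.simps[of 0] H_def)
next
  case False
  assume "r < 19"
  then have "(19 * k + r) div 19 = k" "(19 * k + r) mod 19 = r"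
    by auto
  then show ?thesis using False by (subst dejean.simps) auto
qed

lemma dejean_small: "n < 19 \<Longrightarrow> dejean n = H ! n"
proof -
  assume n: "n < 19"
  then show ?thesis
    using dejean_block[OF n, of 0] H_less[OF n] by (simp add: dejean.simps[of 0])
qed

text \<open>Inside a block adjacent letters of \<open>H\<close> differ; at a block boundary the two
  letters are those of the adjacent blocks, so the claim descends to a smaller index.\<close>

lemma dejean_Suc: "dejean n \<noteq> dejean (Suc n)"
proof (induction n rule: less_induct)
  case (less n)
  define k r where "k = n div 19" "r = n mod 19"
  then have n: "n = 19 * k + r" and r: "r < 19" by auto
  show ?case
  proof (cases "r = 18")
    case True
    have "Suc n = 19 * Suc k + 0" using n True by simp
    then have "dejean (Suc n) = dejean (Suc k)"
      using dejean_block[of 0 "Suc k"] dejean_less[of "Suc k"] by (simp add: H_def)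
    moreover have "dejean n = dejean k"
      using dejean_block[of 18 k] dejean_less[of k] n True by (simp add: H_def)
    moreover have "k < n" using n True by simp
    ultimately show ?thesis using less.IH by simp
  next
    case False
    then have r': "Suc r < 19" using r by simp
    have "Suc n = 19 * k + Suc r" using n by simp
    moreover have "(x + H ! r) mod 3 \<noteq> (x + H ! Suc r) mod 3" if "x < 3" for x
      using that r' H_Suc[of r] H_less[OF r] H_less[OF r'] unfolding less_3_iff by auto
    ultimately show ?thesis
      using dejean_block[OF r, of k] dejean_block[OF r', of k] n dejean_less by simp
  qed
qed

text \<open>For \<open>e = 1\<close> the blocks are the images of letters under Dejean's morphism, for \<open>e = 2\<close>
  those of the morphism conjugated by the negation of letters modulo 3.\<close>

definition blk :: "nat \<Rightarrow> nat \<Rightarrow> nat list" where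
  "blk e z = map (\<lambda>c. (z + e * c) mod 3) H"

text \<open>A fixed point of the morphism sending \<open>z\<close> to \<open>blk e z\<close>, with
  any first letter. This treats \<open>d\<close> and all translates of \<open>-d\<close> at once, 2
  being -1 modulo 3.\<close>

definition block_seq :: "nat \<Rightarrow> (nat \<Rightarrow> nat) \<Rightarrow> bool" where
  "block_seq e f \<longleftrightarrow> e \<in> {1, 2} \<and> (\<forall>k. f k < 3 \<and> f k \<noteq> f (Suc k)) \<and>
     (\<forall>k. \<forall>r<19. f (19 * k + r) = (f k + e * H ! r) mod 3)"

lemma block_seq_dejean: "block_seq 1 dejean"
  by (auto simp: block_seq_def dejean_less dejean_Suc dejean_block)

lemma block_seq_neg_dejean: "block_seq 2 (\<lambda>k. (C + 2 * dejean k) mod 3)"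
proof -
  have "(C mod 3 + 2 * x) mod 3 \<noteq> (C mod 3 + 2 * y) mod 3"
    if "x < 3" "y < 3" "x \<noteq> y" for x y
    using that mod_less_divisor[of 3 C] unfolding less_3_iff by auto
  then have "(C + 2 * dejean k) mod 3 \<noteq> (C + 2 * dejean (Suc k)) mod 3" for k
    using dejean_Suc[of k] dejean_less[of k] dejean_less[of "Suc k"]
    by (metis mod_add_left_eq)
  moreover have "(C + 2 * ((x + h) mod 3)) mod 3 = ((C + 2 * x) mod 3 + 2 * h) mod 3" for x h :: nat
  proof -
    have "(C + 2 * ((x + h) mod 3)) mod 3 = (C + 2 * (x + h)) mod 3"
      by (metis mod_add_right_eq mod_mult_right_eq)
    then show ?thesis by (simp add: mod_simps algebra_simps)
  qed
  ultimately show ?thesis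
    by (auto simp: block_seq_def dejean_block)
qed

lemma length_blk [simp]: "length (blk e z) = 19"
  by (simp add: blk_def)

lemma map_block:
  assumes "block_seq e f"
  shows "map f [19 * k..<19 * k + 19] = blk e (f k)"
  using assms by (intro nth_equalityI) (auto simp: blk_def block_seq_def)

lemma map_two_blocks:
  assumes "block_seq e f"
  shows "map f [19 * k..<19 * k + 38] = blk e (f k) @ blk e (f (Suc k))"
proof -
  have "[19 * k..<19 * k + 38] = [19 * k..<19 * k + 19] @ [19 * Suc k..<19 * Suc k + 19]"
    using upt_add_eq_append[of "19 * k" "19 * k + 19" 19] by (simp add: add_ac)
  then show ?thesis by (simp only: map_append map_block[OF assms])
qed

lemma map_38:
  assumes "block_seq e f" "r \<le> 19"
  shows "map f [19 * k + r..<19 * k + r + 38]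
    = drop r (blk e (f k)) @ blk e (f (Suc k)) @ take r (blk e (f (Suc (Suc k))))"
proof -
  have "[19 * k + r..<19 * k + r + 38]
    = drop r [19 * k..<19 * k + 19] @ [19 * Suc k..<19 * Suc k + 19]
      @ take r [19 * Suc (Suc k)..<19 * Suc (Suc k) + 19]"
    using assms(2) upt_add_eq_append[of "19 * k + r" "19 * k + 19" "19 + r"]
      upt_add_eq_append[of "19 * k + 19" "19 * k + 38" r] by (simp add: add_ac)
  then show ?thesis
    by (simp only: map_append drop_map[symmetric] take_map[symmetric] map_block[OF assms(1)])
qed

section \<open>Windows of block sequences, synchronization and descent\<close>

definition letter_pairs :: "(nat \<times> nat) list" where
  "letter_pairs = filter (\<lambda>(x, y). x \<noteq> y) (List.product [0, 1, 2] [0, 1, 2])"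

lemma letter_pairs: "x < 3 \<Longrightarrow> y < 3 \<Longrightarrow> x \<noteq> y \<Longrightarrow> (x, y) \<in> set letter_pairs"
  unfolding less_3_iff by (elim disjE) (simp_all add: letter_pairs_def)

definition windows_at :: "nat \<Rightarrow> nat \<Rightarrow> nat \<Rightarrow> nat list list" where
  "windows_at L e r = map (\<lambda>(x, y). take L (drop r (blk e x @ blk e y))) letter_pairs"

definition factors :: "nat \<Rightarrow> nat \<Rightarrow> nat list list" where
  "factors L e = concat (map (windows_at L e) [0..<19])"

lemma window_in:
  assumes "block_seq e f" "L \<le> 20"
  shows "map f [i..<i + L] \<in> set (windows_at L e (i mod 19))"
proof -
  define k r where "k = i div 19" "r = i mod 19"
  then have i: "i = 19 * k + r" and r: "r < 19" by auto
  have "map f [i..<i + L] = take L (drop r (map f [19 * k..<19 * k + 38]))"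
    using r assms(2) by (simp add: i take_map drop_map add_ac)
  also have "\<dots> = take L (drop r (blk e (f k) @ blk e (f (Suc k))))"
    by (simp only: map_two_blocks[OF assms(1)])
  finally have eq: "map f [i..<i + L] = take L (drop r (blk e (f k) @ blk e (f (Suc k))))" .
  have "(f k, f (Suc k)) \<in> set letter_pairs"
    using assms(1) by (auto simp: block_seq_def intro: letter_pairs)
  then show ?thesis
    unfolding eq windows_at_def k_r_def(2)[symmetric] set_map by (rule rev_image_eqI) simp
qed

lemma window_in_factors:
  assumes "block_seq e f" "L \<le> 20"
  shows "map f [i..<i + L] \<in> set (factors L e)"
  using window_in[OF assms, of i] by (auto simp: factors_def intro!: bexI[of _ "i mod 19"])

lemma check_synchronization:
  "list_all (\<lambda>e. list_all (\<lambda>r. avoids (fold insert_word (windows_at 10 e r) Leaf)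
     (concat (map (windows_at 10 e) [Suc r..<19]))) [0..<19]) [1, 2]"
  by code_simp

text \<open>If \<open>l < 10\<close> then \<open>p < 12\<close>, and a repetition has at most 11 + 9
  letters; from an offset of at most 18 it ends within two blocks.\<close>

lemma check_two_blocks:
  "list_all (\<lambda>e. list_all (\<lambda>(x, y). short_free 12 (blk e x @ blk e y))
     letter_pairs) [1, 2]"
  by code_simp


text \<open>Descent on the period. If \<open>l < 10\<close>, the repetition fits into two blocks and
  evaluation excludes it. Otherwise synchronization makes 19 divide \<open>p\<close>, and the blocks
  that meet \<open>x\<close> give a repetition of period \<open>p div 19\<close> whose exponent is
  no smaller.\<close>

lemma block_seq_free:
  assumes f: "block_seq e f"
  shows "\<not> long_rep f i p l"
proof (induction p arbitrary: i l rule: less_induct)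
  case (less p)
  have e: "e \<in> {1, 2}" using f by (simp add: block_seq_def)
  show ?case
  proof
    assume R: "long_rep f i p l"
    then have p: "0 < p" and pl: "3 * p < 4 * l" and eq: "j < l \<Longrightarrow> f (i + j) = f (i + p + j)" for j
      by (auto simp: long_rep_def)
    show False
    proof (cases "l < 10")
      case True
      define k where "k = i div 19"
      have "(f k, f (Suc k)) \<in> set letter_pairs"
        using f by (auto simp: block_seq_def intro: letter_pairs)
      then have "short_free 12 (map f [19 * k..<19 * k + 38])"
        using check_two_blocks e unfolding map_two_blocks[OF f] list_all_iff by auto
      moreover have "19 * k \<le> i" "i \<le> 19 * k + 18"
        unfolding k_def by presburger+
      moreover have "p < 12" "3 * p div 4 + 1 \<le> l"
        using True pl by linarith+
      ultimately have "\<not> long_rep f i p l"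
        using True by (intro short_freeD) auto
      then show False using R by blast
    next
      case False
      then have "map f [i..<i + 10] = map f [i + p..<i + p + 10]"
        using eq by (intro nth_equalityI) auto
      then have W: "map f [i..<i + 10] \<in> set (windows_at 10 e (i mod 19))"
          "map f [i..<i + 10] \<in> set (windows_at 10 e ((i + p) mod 19))"
        using window_in[OF f, of 10 i] window_in[OF f, of 10 "i + p"] by auto
      have sync: False if "w \<in> set (windows_at 10 e r)" "w \<in> set (windows_at 10 e s)"
        "r < s" "s < 19" for w r s
      proof -
        have "avoids (fold insert_word (windows_at 10 e r) Leaf)
          (concat (map (windows_at 10 e) [Suc r..<19]))"
          using check_synchronization e that by (auto simp: list_all_iff)
        moreover have "w \<in> set (concat (map (windows_at 10 e) [Suc r..<19]))"
          using that by auto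
        ultimately show False
          using avoidsD has_word_fold[OF that(1)] by blast
      qed
      have "i mod 19 = (i + p) mod 19"
        using sync[OF W] sync[OF W(2) W(1)] by (meson linorder_neqE_nat mod_less_divisor zero_less_numeral)
      then have "19 dvd p"
        by (metis add_diff_cancel_left' le_add1 mod_eq_dvd_iff_nat)
      then obtain q where q: "p = 19 * q" by blast
      define a b where "a = i div 19" "b = (i + l - 1) div 19"
      have ab: "a \<le> b" using False by (auto simp: a_b_def intro: div_le_mono)
      have "f K = f (K + q)" if K: "a \<le> K" "K \<le> b" for K
      proof -
        \<comment> \<open>\<open>j\<close> lies both in block \<open>K\<close> and in the first
          \<open>x\<close>, which may meet the block only in part; distinct letters have images that
          differ everywhere, so one common position identifies the block.\<close>
        define j where "j = max i (19 * K)"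
        have "19 * a \<le> i" "i < 19 * a + 19" "19 * b \<le> i + l - 1" "i + l - 1 < 19 * b + 19"
          by (auto simp: a_b_def)
        then have j: "i \<le> j" "j < i + l" "19 * K \<le> j" "j < 19 * K + 19"
          using K False unfolding j_def by auto
        define r where "r = j - 19 * K"
        have r: "r < 19" "j = 19 * K + r" "j + p = 19 * (K + q) + r"
          using j by (auto simp: r_def q)
        have "f j = f (j + p)"
          using eq[of "j - i"] j by (simp add: add_ac)
        then have "(f K + e * H ! r) mod 3 = (f (K + q) + e * H ! r) mod 3"
          using f r unfolding block_seq_def by metis
        then show ?thesis
          using f mod_3_cancel unfolding block_seq_def by metis
      qed
      then have "\<forall>j<b - a + 1. f (a + j) = f (a + q + j)"
        using ab by (auto simp: add_ac)
      moreover have "l \<le> 19 * (b - a + 1)"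
      proof -
        have "19 * a \<le> i" "i + l - 1 < 19 * b + 19"
          by (auto simp: a_b_def)
        then show ?thesis using ab by (simp add: diff_mult_distrib2)
      qed
      ultimately have "long_rep f a q (b - a + 1)"
        using pl p by (auto simp: long_rep_def q)
      moreover have "q < p" using p q by simp
      ultimately show False using less.IH by blast
    qed
  qed
qed

section \<open>The circular words\<close>

definition wins :: "nat \<Rightarrow> 'a list \<Rightarrow> 'a list list" where
  "wins L w = map (\<lambda>i. take L (drop i w)) [0..<length w + 1 - L]"

lemma wins_map:
  assumes "a + L \<le> b"
  shows "wins L (map f [a..<b]) = map (\<lambda>i. map f [i..<i + L]) [a..<b + 1 - L]"
proof (rule nth_equalityI)
  fix i assume "i < length (wins L (map f [a..<b]))"
  then have i: "a + i + L \<le> b" using assms by (auto simp: wins_def)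
  then show "wins L (map f [a..<b]) ! i = map (\<lambda>i. map f [i..<i + L]) [a..<b + 1 - L] ! i"
    using assms by (simp add: wins_def take_map drop_map del: upt_Suc)
qed (use assms in \<open>auto simp: wins_def\<close>)

text \<open>\<open>U\<close>, \<open>y\<close>, \<open>V\<close>, \<open>t\<close> end at
  \<open>a\<close>, \<open>b\<close>, \<open>c\<close>, \<open>n\<close>. For
  \<open>l \<ge> 18\<close>, equal windows in the two copies of \<open>x\<close> start at different
  places of the circle, so by \<open>Z\<close> they avoid the connectors, and \<open>UV\<close> puts
  both copies into the same segment.\<close>

lemma circular_assembly:
  fixes f :: "nat \<Rightarrow> nat"
  assumes per: "\<And>i. f (i + n) = f i"
    and ord: "38 \<le> a" "a < b" "b \<le> c" "c < n"
    and U: "\<And>i p l. i + p + l \<le> a \<Longrightarrow> \<not> long_rep f i p l"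
    and V: "\<And>i p l. b \<le> i \<Longrightarrow> i + p + l \<le> c \<Longrightarrow> \<not> long_rep f i p l"
    and UV: "\<And>i j. i + 18 \<le> a \<Longrightarrow> b \<le> j \<Longrightarrow> j + 18 \<le> c
      \<Longrightarrow> map f [i..<i + 18] \<noteq> map f [j..<j + 18]"
    and Z: "\<And>i j. i < n \<Longrightarrow> j < n \<Longrightarrow> a < i + 18 \<and> i < b \<or> c < i + 18
      \<Longrightarrow> map f [i..<i + 18] = map f [j..<j + 18] \<Longrightarrow> i = j"
    and S: "\<And>i p l. a \<le> i + 38 \<Longrightarrow> i + p + (3 * p div 4 + 1) \<le> b + 38 \<Longrightarrow> p < 23
      \<Longrightarrow> \<not> long_rep f i p l"
    and T: "\<And>i p l. c \<le> i + 38 \<Longrightarrow> i + p + (3 * p div 4 + 1) \<le> n + 38 \<Longrightarrow> p < 23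
      \<Longrightarrow> \<not> long_rep f i p l"
    and bal: "a \<le> 6 * (n - a)" "c - b \<le> 6 * (n - (c - b))"
    and "i < n" "p + l \<le> n"
  shows "\<not> long_rep f i p l"
proof
  assume R: "long_rep f i p l"
  then have p: "0 < p" and pl: "3 * p < 4 * l" and eq: "j < l \<Longrightarrow> f (i + j) = f (i + p + j)" for j
    by (auto simp: long_rep_def)
  have f_mod: "f (x mod n) = f x" for x
  proof -
    have "f (x + k * n) = f x" for x k
      by (induction k) (use per in \<open>auto simp: add_ac\<close>, metis add.assoc add.commute)
    from this[of "x mod n" "x div n"] show ?thesis by simp
  qed
  show False
  proof (cases "l < 18")
    case True
    then have p23: "p < 23" and k: "3 * p div 4 + 1 \<le> l" using pl by linarith+
    have "i + p + l \<le> i + 39" using True pl by linarith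
    show False
    proof (cases "i < b")
      case True
      then show False
        using U[of i p l] S[of i p l] R p23 k \<open>i + p + l \<le> i + 39\<close>
        by (cases "i + p + l \<le> a") linarith+
    next
      case False
      then show False
        using V[of i p l] T[of i p l] R p23 k \<open>i + p + l \<le> i + 39\<close> \<open>i < n\<close>
        by (cases "i + p + l \<le> c") linarith+
    qed
  next
    case False
    have win_mod: "map f [x mod n..<x mod n + 18] = map f [x..<x + 18]" for x
    proof (intro nth_equalityI; simp)
      fix j :: nat
      show "f (x mod n + j) = f (x + j)"
        by (metis f_mod mod_add_left_eq)
    qed
    have win: "map f [(i + j) mod n..<(i + j) mod n + 18]
        = map f [(i + p + j) mod n..<(i + p + j) mod n + 18]" if "j + 18 \<le> l" for j
    proof -
      have "f (i + j + k) = f (i + p + j + k)" if "k < 18" for k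
        using eq[of "j + k"] that \<open>j + 18 \<le> l\<close> by (simp add: add_ac)
      then show ?thesis
        unfolding win_mod by (intro nth_equalityI) auto
    qed
    define i' where "i' = (i + p) mod n"
    have n: "0 < n" using \<open>i < n\<close> by simp
    have ne: "(i + j) mod n \<noteq> (i + p + j) mod n" for j
    proof
      assume "(i + j) mod n = (i + p + j) mod n"
      then have "n dvd i + p + j - (i + j)"
        by (metis mod_eq_dvd_iff_nat le_add1 add.commute add.left_commute)
      then show False using p \<open>p + l \<le> n\<close> False by (auto dest: dvd_imp_le)
    qed
    have nz: "\<not> (a < x + 18 \<and> x < b \<or> c < x + 18)"
      if "j + 18 \<le> l" "x = (i + j) mod n \<or> x = (i + p + j) mod n" for j x
      using that Z[of "(i + j) mod n" "(i + p + j) mod n"] Z[of "(i + p + j) mod n" "(i + j) mod n"]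
        win[OF that(1)] ne[of j] n by (metis mod_less_divisor)
    have seg: "x + l \<le> a \<or> b \<le> x \<and> x + l \<le> c" if x: "x = i \<or> x = i'" for x
    proof -
      have xn: "x < n" using x \<open>i < n\<close> n by (auto simp: i'_def)
      have nzx: "\<not> (a < x + j + 18 \<and> x + j < b \<or> c < x + j + 18)"
        if "j + 18 \<le> l" "x + j < n" for j
      proof (rule nz[OF that(1)])
        show "x + j = (i + j) mod n \<or> x + j = (i + p + j) mod n"
          using x that(2) by (auto simp: i'_def) (metis mod_add_left_eq mod_less)
      qed
      have "x + 18 \<le> a \<or> b \<le> x \<and> x + 18 \<le> c"
        using nzx[of 0] False xn by auto
      then show ?thesis
      proof
        assume xa: "x + 18 \<le> a"
        show ?thesis
        proof (rule ccontr)
          assume "\<not> ?thesis"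
          \<comment> \<open>The window at \<open>a - 17\<close> is the first one to end beyond
            \<open>U\<close>, so it meets the connector.\<close>
          then have "a - 17 - x + 18 \<le> l" "x + (a - 17 - x) = a - 17"
            using xa by linarith+
          then show False
            using nzx[of "a - 17 - x"] xa ord by linarith
        qed
      next
        assume xc: "b \<le> x \<and> x + 18 \<le> c"
        show ?thesis
        proof (rule ccontr)
          assume "\<not> ?thesis"
          then have "c - 17 - x + 18 \<le> l" "x + (c - 17 - x) = c - 17"
            using xc by linarith+
          then show False
            using nzx[of "c - 17 - x"] xc ord by linarith
        qed
      qed
    qed
    have i': "i' = i + p \<or> i' + n = i + p"
    proof -
      have "i + p < 2 * n" using \<open>i < n\<close> \<open>p + l \<le> n\<close> pl by simp
      then show ?thesis unfolding i'_def
        by (cases "i + p < n") (auto simp: mod_if)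
    qed
    have "map f [i..<i + 18] = map f [i'..<i' + 18]"
      using win[of 0] False \<open>i < n\<close> unfolding i'_def by simp
    then consider "i + l \<le> a" "i' + l \<le> a" | "b \<le> i" "i + l \<le> c" "b \<le> i'" "i' + l \<le> c"
      using seg[of i] seg[of i'] UV[of i i'] UV[of i' i] False by fastforce
    then show False
    proof cases
      \<comment> \<open>Either the repetition lies in \<open>U\<close>, or it runs around the circle
        with \<open>i' + n = i + p\<close>. Then \<open>p \<ge> n - a + l\<close>, so
        \<open>3 * p < 4 * l\<close> gives \<open>l > 3 * (n - a)\<close>, while
        \<open>p + l \<le> n\<close> gives \<open>2 * l \<le> a\<close>, contrary to
        \<open>bal\<close>.\<close>
      case 1
      then show False
        using i' U[of i p l] R bal(1) pl \<open>p + l \<le> n\<close> ord by (elim disjE) auto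
    next
      case 2
      then show False
        using i' V[of i p l] R bal(2) pl \<open>p + l \<le> n\<close> ord by (elim disjE) auto
    qed
  qed
qed


text \<open>The neighbourhoods of the connectors. If \<open>x\<close> has length at most 17, then the period is at most
  22 and \<open>x y x\<close> has length at most 39, so 38 letters on each side suffice. The windows of length 18
  that meet the connector extend to 17 of these letters; \<open>middle\<close> below cuts off the other 21.\<close>

definition opening_context :: "nat \<Rightarrow> nat \<Rightarrow> nat \<Rightarrow> nat list" where
  "opening_context x z y = drop 9 (blk 1 x) @ blk 1 z @ take 9 (blk 1 y) @ [y]
     @ drop 10 (blk 2 y) @ blk 2 ((y + 2) mod 3) @ take 10 (blk 2 ((y + 1) mod 3))"

text \<open>\<open>U\<close> starts at position 3 of \<open>d\<close>, and \<open>V\<close> is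
  translated so that its last three blocks belong to 1, 2, 0; the context thus depends on the
  closing alone.\<close>

definition closing_context :: "nat \<Rightarrow> nat list \<Rightarrow> nat list" where
  "closing_context q t = drop q (blk 2 1) @ blk 2 2 @ take q (blk 2 0) @ t
     @ drop 3 (blk 1 0) @ blk 1 1 @ take 3 (blk 1 2)"

text \<open>Found by a backtracking search. The letter block in which \<open>V\<close> ends is cut after \<open>q\<close> letters; the
  entry number \<open>r\<close> serves the lengths congruent to \<open>r\<close> modulo 19.\<close>

definition closings :: "(nat \<times> nat list) list" where
  "closings =
  [(9, [0, 1, 0, 2, 1, 2, 0, 2, 1, 0, 2, 0, 1, 2, 1, 0, 2, 1, 2, 0, 1, 0, 2, 1, 0, 1, 2, 1, 0,
    2, 0, 1]),
   (9, [0, 1, 0, 2, 1, 2, 0, 2, 1, 0, 1, 2, 0, 1]),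
   (16, [2, 0, 1, 2, 0, 2, 1, 0, 1, 2, 1, 0, 2, 0, 1, 0, 2, 1, 2, 0, 2, 1, 0, 1, 2, 0, 1]),
   (16, [2, 0, 1, 2, 0, 2, 1, 0, 1, 2, 1, 0, 2, 0, 1, 0, 2, 1, 0, 1, 2, 0, 2, 1, 0, 2, 0, 1,
    2, 1, 0, 2, 1, 2, 0, 1, 0, 2, 1, 0, 1, 2, 1, 0, 2, 0, 1]),
   (9, [0, 1, 0, 2, 1, 2, 0, 2, 1, 0, 2, 0, 1, 2, 1, 0, 2, 1, 2, 0, 2, 1, 0, 1, 2, 1, 0, 2, 0,
    1, 0, 2, 1, 0, 1, 2, 0, 2, 1, 0, 2, 0, 1, 0, 2, 1, 2, 0, 2, 1, 0, 1, 2, 0, 1]),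
   (9, [0, 1, 0, 2, 1, 2, 0, 2, 1, 0, 1, 2, 0, 1, 0, 2, 1, 2, 0, 1, 2, 1, 0, 2, 0, 1, 0, 2, 1,
    2, 0, 2, 1, 0, 2, 0, 1, 2, 1, 0, 2, 1, 2, 0, 1, 0, 2, 1, 0, 1, 2, 1, 0, 2, 0, 1]),
   (16, [2, 0, 1, 2, 0, 2, 1, 0, 1, 2, 0, 1]),
   (9, [0, 1, 0, 2, 1, 2, 0, 2, 1, 0, 2, 0, 1, 2, 1, 0, 2, 1, 2, 0, 2, 1, 0, 1, 2, 1, 0, 2, 0,
    1, 2, 0, 2, 1, 0, 1, 2, 0, 1]),
   (9, [0, 1]),
   (16, [2, 0, 1, 2, 0, 2, 1, 0, 1, 2, 1, 0, 2, 0, 1]),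
   (9, [0, 1, 0, 2, 1, 2, 0, 1, 2, 1, 0, 2, 0, 1, 2, 0, 2, 1, 0, 1, 2, 0, 1]),
   (9, [0, 1, 0, 2, 1, 0, 1, 2, 0, 2, 1, 0, 2, 0, 1, 0, 2, 1, 2, 0, 2, 1, 0, 1, 2, 1, 0, 2, 1,
    2, 0, 1, 0, 2, 1, 0, 1, 2, 1, 0, 2, 0, 1]),
   (9, [0, 1, 0, 2, 1, 2, 0, 2, 1, 0, 1, 2, 1, 0, 2, 1, 2, 0, 1, 0, 2, 1, 0, 1, 2, 0, 2, 1, 0,
    2, 0, 1, 0, 2, 1, 2, 0, 2, 1, 0, 1, 2, 0, 1]),
   (16, [2, 0, 1, 2, 0, 2, 1, 0, 1, 2, 1, 0, 2, 0, 1, 0, 2, 1, 0, 1, 2, 0, 2, 1, 0, 2, 0, 1,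
    2, 1, 0, 2, 1, 2, 0, 2, 1, 0, 1, 2, 1, 0, 2, 0, 1, 0, 2, 1, 2, 0, 2, 1, 0, 1, 2, 0, 1]),
   (9, [0, 1, 0, 2, 1, 0, 1, 2, 0, 2, 1, 0, 2, 0, 1, 0, 2, 1, 2, 0, 2, 1, 0, 1, 2, 0, 1]),
   (16, [2, 0, 1, 2, 0, 2, 1, 0, 1, 2, 1, 0, 2, 0, 1, 0, 2, 1, 0, 1, 2, 0, 2, 1, 0, 2, 0, 1,
    0, 2, 1, 2, 0, 2, 1, 0, 1, 2, 0, 1]),
   (9, [0, 1, 0, 2, 1, 0, 1, 2, 0, 2, 1, 0, 2, 0, 1, 0, 2, 1, 2, 0, 2, 1, 0, 1, 2, 0, 1, 0, 2,
    1, 2, 0, 1, 2, 1, 0, 2, 0, 1, 0, 2, 1, 2, 0, 2, 1, 0, 2, 0, 1, 2, 1, 0, 2, 1, 2, 0, 2, 1, 0,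
    1, 2, 1, 0, 2, 0, 1]),
   (9, [0, 1, 0, 2, 1, 2, 0, 2, 1, 0, 1, 2, 1, 0, 2, 1, 2, 0, 1, 0, 2, 1, 0, 1, 2, 1, 0, 2, 0,
    1]),
   (16, [2, 0, 1, 2, 0, 2, 1, 0, 1, 2, 1, 0, 2, 0, 1, 0, 2, 1, 0, 1, 2, 0, 2, 1, 0, 2, 0, 1,
    0, 2, 1, 2, 0, 2, 1, 0, 1, 2, 1, 0, 2, 0, 1])]"

definition middle :: "'a list \<Rightarrow> 'a list" where
  "middle w = drop 21 (take (length w - 21) w)"

definition letter_triples :: "(nat \<times> nat \<times> nat) list" where
  "letter_triples = filter (\<lambda>(x, z, y). x \<noteq> z \<and> z \<noteq> y)
     (List.product [0, 1, 2] (List.product [0, 1, 2] [0, 1, 2]))"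

lemma letter_triples:
  "x < 3 \<Longrightarrow> z < 3 \<Longrightarrow> y < 3 \<Longrightarrow> x \<noteq> z \<Longrightarrow> z \<noteq> y \<Longrightarrow> (x, z, y) \<in> set letter_triples"
  unfolding less_3_iff by (elim disjE) (simp_all add: letter_triples_def)

definition factor_trie :: trie where
  "factor_trie = fold insert_word (factors 18 1 @ factors 18 2) Leaf"

definition opening_windows :: "nat list list" where
  "opening_windows = concat (map (\<lambda>(x, z, y). wins 18 (middle (opening_context x z y))) letter_triples)"

lemma check_factors: "avoids (fold insert_word (factors 18 1) Leaf) (factors 18 2)"
  by code_simp

lemma check_opening_short: "list_all (\<lambda>(x, z, y). short_free 23 (opening_context x z y)) letter_triples"
  by code_simp

text \<open>The triples are checked one by one, since a circular word contains only one
  opening.\<close>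

lemma check_opening_windows:
  "list_all (fresh factor_trie)
     (map (\<lambda>(x, z, y). wins 18 (middle (opening_context x z y))) letter_triples)"
  by code_simp

lemma check_closing_short: "list_all (\<lambda>(q, t). short_free 23 (closing_context q t)) closings"
  by code_simp

text \<open>The trie holds the windows of all openings, so each closing can be combined with each
  opening.\<close>

lemma check_closing_windows:
  "list_all (fresh (fold insert_word opening_windows factor_trie))
     (map (\<lambda>(q, t). wins 18 (middle (closing_context q t))) closings)"
  by code_simp

text \<open>The circular word will have length \<open>19 * (m + M - v) + q + length t - 3\<close>,
  where 3 is the position at which \<open>U\<close> starts in \<open>d\<close>.\<close>

lemma check_closings:
  "list_all (\<lambda>(r, q, t). (q + length t) mod 19 = (r + 3) mod 19 \<and> length t < 70 \<and> 0 < length t \<and>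
     (q = 9 \<or> q = 16) \<and> set t \<subseteq> {0, 1, 2}) (zip [0..<19] closings)"
  by code_simp

text \<open>The junctions need \<open>V\<close> to start with the images of \<open>a\<close>, \<open>a + 1\<close>, \<open>a + 2\<close> and to end in those
  of \<open>a + 2\<close>, \<open>a + 1\<close>, \<open>a\<close> for some letters \<open>a\<close>. The lists are the positions in a block of \<open>d\<close> where
  such ascending triples start and where descending ones end.\<close>

lemma check_parameters:
  "list_all (\<lambda>k. list_ex (\<lambda>r. let s = (k + 19 - r) mod 19 in
     list_all (\<lambda>(x, y). list_all (\<lambda>c. list_ex (\<lambda>v.
       ((if s + v < 19 then x + H ! (s + v) else y + H ! (s + v - 19)) + H ! v) mod 3 = c)
     [0, 1, 5, 6, 7, 13]) [0, 1, 2]) letter_pairs) [5, 11, 12, 13, 17, 18]) [0..<19]"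
  by code_simp


section \<open>Assembling the circular word from given positions\<close>

lemma inj_windows:
  "distinct (map F [x..<y]) \<Longrightarrow> i \<in> {x..<y} \<Longrightarrow> j \<in> {x..<y} \<Longrightarrow> F i = F j \<Longrightarrow> i = j"
  by (auto simp: distinct_map inj_on_def)

text \<open>\<open>U\<close> ends in block \<open>m\<close> of \<open>d\<close>; \<open>V\<close>
  runs from block \<open>v\<close> to block \<open>M\<close> of a translate of \<open>-d\<close>.
  The conditions on the letters at \<open>v\<close> and \<open>M\<close>, with \<open>match\<close>,
  bring both junctions into the forms covered by the finite checks.\<close>

lemma circular_construction:
  assumes m: "2 \<le> m" and M: "v + 3 \<le> M" and qt: "(q, t) \<in> set closings"
    and v: "dejean (Suc v) = (dejean v + 1) mod 3" "dejean (Suc (Suc v)) = (dejean v + 2) mod 3"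
    and dM: "dejean (M - 1) = (dejean M + 1) mod 3" "dejean (M - 2) = (dejean M + 2) mod 3"
    and match: "(dejean m + dejean v) mod 3 = dejean M"
    and a: "a = 19 * m + 6" and c: "c + 19 * v + 9 = a + 19 * M + q" and n: "n = c + length t"
    and bal: "a \<le> 6 * (n - a)" "c - (a + 1) \<le> 6 * (n - (c - (a + 1)))"
  shows "\<exists>w. length w = n \<and> kary 3 w \<and>
    (\<forall>i p l. i < n \<longrightarrow> p + l \<le> n \<longrightarrow> \<not> long_rep (\<lambda>i. w ! (i mod n)) i p l)"
proof -
  have q: "q = 9 \<or> q = 16" and t: "0 < length t" "set t \<subseteq> {0, 1, 2}"
  proof -
    from qt obtain r where "r < length closings" "closings ! r = (q, t)"
      by (metis in_set_conv_nth)
    moreover have "length closings = 19" by (simp add: closings_def)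
    ultimately have "(r, q, t) \<in> set (zip [0..<19] closings)"
      by (force simp: set_zip)
    then show "q = 9 \<or> q = 16" "0 < length t" "set t \<subseteq> {0, 1, 2}"
      using check_closings by (auto simp: list_all_iff)
  qed
  \<comment> \<open>The translate is chosen so that \<open>e v = dejean m\<close>, as
    \<open>3 * dejean v\<close> vanishes modulo 3; \<open>match\<close> then amounts to
    \<open>e M = 0\<close>.\<close>
  define e where "e k = (dejean m + dejean v + 2 * dejean k) mod 3" for k
  define b where "b = a + 1"
  define g where "g i = (if i < a then dejean (i + 3) else if i = a then dejean m
    else if i < c then e (19 * v + 10 + (i - b)) else t ! (i - c))" for i
  define f where "f i = g (i mod n)" for i
  have e: "block_seq 2 e"
    using block_seq_neg_dejean[of "dejean m + dejean v"] by (simp add: e_def[abs_def])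
  have bc: "b + 38 \<le> c" and cn: "c < n" and a38: "38 \<le> a"
    using q t m M c n a by (auto simp: b_def)
  have cV: "19 * v + 10 + (c - b) = 19 * M + q"
    using c bc by (simp add: b_def)
  have f_less: "f i = g i" if "i < n" for i
    using that by (simp add: f_def)
  have per: "f (i + n) = f i" for i
    by (simp add: f_def)
  have fU: "map f [i..<j] = map dejean [i + 3..<j + 3]" if "j \<le> a" for i j
    using that bc cn by (intro nth_equalityI) (auto simp: f_less g_def b_def add_ac)
  have f_e: "f (i + k) = e (19 * v + 10 + (i - b) + k)" if "b \<le> i" "i + k < c" for i k
  proof -
    have "i + k - b = i - b + k" using that by simp
    then show ?thesis using that cn by (simp add: f_less g_def b_def add_ac)
  qed
  have fV: "map f [i..<j] = map e [19 * v + 10 + (i - b)..<19 * v + 10 + (j - b)]"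
    if "b \<le> i" "j \<le> c" for i j
  proof (rule nth_equalityI)
    show "length (map f [i..<j]) = length (map e [19 * v + 10 + (i - b)..<19 * v + 10 + (j - b)])"
      using that by auto
    fix k assume "k < length (map f [i..<j])"
    then have "i + k < c" "k < j - i" "k < j - b - (i - b)"
      using that by auto
    then show "map f [i..<j] ! k = map e [19 * v + 10 + (i - b)..<19 * v + 10 + (j - b)] ! k"
      using that by (simp add: f_e)
  qed
  have rU: "long_rep f i p l \<Longrightarrow> long_rep dejean (i + 3) p l" if "i + p + l \<le> a" for i p l
    using that bc cn unfolding long_rep_def
    by (auto simp: f_less g_def b_def add_ac)
  have rV: "long_rep f i p l \<Longrightarrow> long_rep e (19 * v + 10 + (i - b)) p l"
    if "b \<le> i" "i + p + l \<le> c" for i p l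
    using that f_e[of i] f_e[of i "p + j" for j] unfolding long_rep_def by (auto simp: add.assoc)
  define x z y where "x = dejean (m - 2)" "z = dejean (m - 1)" "y = dejean m"
  have y3: "y < 3" by (simp add: x_z_y_def dejean_less)
  have xzy: "(x, z, y) \<in> set letter_triples"
  proof -
    have "m - 1 = Suc (m - 2)" "m = Suc (m - 1)" using m by auto
    then have "x \<noteq> z" "z \<noteq> y"
      unfolding x_z_y_def using dejean_Suc by metis+
    moreover have "x < 3" "z < 3" "y < 3" by (auto simp: x_z_y_def dejean_less)
    ultimately show ?thesis by (intro letter_triples)
  qed
  \<comment> \<open>The connector letter takes the middle place of a block: the first half of the
    image of \<open>y\<close> precedes it, and the second half of the image under the conjugated
    morphism follows.\<close>
  have open_ctx: "map f [a - 38..<b + 38] = opening_context x z y"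
  proof -
    have 1: "[a - 38..<b + 38] = [a - 38..<a] @ [a] @ [b..<b + 38]"
    proof -
      have "[a - 38..<a + 39] = [a - 38..<a] @ [a..<a + 39]"
        by (rule upt_add_eq_append) simp
      moreover have "[a..<a + 39] = [a] @ [b..<a + 39]"
        by (simp add: upt_conv_Cons b_def del: upt_Suc)
      moreover have "b + 38 = a + 39" by (simp add: b_def)
      ultimately show ?thesis by (simp only:)
    qed
    have "a - 38 + 3 = 19 * (m - 2) + 9" "a + 3 = 19 * (m - 2) + 9 + 38"
      using m by (auto simp: a)
    moreover have "m - 1 = Suc (m - 2)" "m = Suc (Suc (m - 2))" using m by auto
    ultimately have 2: "map f [a - 38..<a]
      = drop 9 (blk 1 x) @ blk 1 z @ take 9 (blk 1 y)"
      using map_38[OF block_seq_dejean, of 9 "m - 2"]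
      by (simp only: fU x_z_y_def)
    have 3: "f a = y"
      using bc cn by (simp add: f_less g_def b_def x_z_y_def)
    have ev: "e v = y" "e (Suc v) = (y + 2) mod 3" "e (Suc (Suc v)) = (y + 1) mod 3"
      using dejean_less[of m] dejean_less[of v] v unfolding e_def x_z_y_def less_3_iff by auto
    have 4: "map f [b..<b + 38]
      = drop 10 (blk 2 y) @ blk 2 ((y + 2) mod 3) @ take 10 (blk 2 ((y + 1) mod 3))"
      using bc map_38[OF e, of 10 v] by (simp add: fV ev)
    show ?thesis
      unfolding 1 opening_context_def by (simp add: 2 3 4)
  qed
  have close_ctx: "map f [c - 38..<n + 38] = closing_context q t"
  proof -
    have 1: "[c - 38..<n + 38] = [c - 38..<c] @ [c..<n] @ [n..<n + 38]"
      using upt_add_eq_append[of "c - 38" c "n + 38 - c"] upt_add_eq_append[of c n 38] bc cn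
      by simp
    have eM: "e M = 0" "e (Suc (M - 2)) = 2" "e (M - 2) = 1"
    proof -
      have "e k = (dejean M + 2 * dejean k) mod 3" for k
        by (simp add: e_def mod_simps flip: match)
      moreover have "(x + 2 * x) mod 3 = 0" "(x + 2 * ((x + 1) mod 3)) mod 3 = 2"
        "(x + 2 * ((x + 2) mod 3)) mod 3 = 1" if "x < 3" for x :: nat
        using that unfolding less_3_iff by auto
      moreover have "Suc (M - 2) = M - 1" using M by simp
      ultimately show "e M = 0" "e (Suc (M - 2)) = 2" "e (M - 2) = 1"
        using dM dejean_less[of M] by metis+
    qed
    have "19 * v + 10 + (c - 38 - b) = 19 * (M - 2) + q" "19 * v + 10 + (c - b) = 19 * (M - 2) + q + 38"
      using cV bc M by auto
    moreover have "Suc (Suc (M - 2)) = M" "q \<le> 19" using M q by auto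
    ultimately have 2: "map f [c - 38..<c] = drop q (blk 2 1) @ blk 2 2 @ take q (blk 2 0)"
      using bc map_38[OF e, of q "M - 2"] by (simp add: fV eM)
    have 3: "map f [c..<n] = t"
      using bc cn n by (intro nth_equalityI) (auto simp: f_less g_def b_def)
    have "map f [n..<n + 38] = map f [0..<38]"
      by (intro nth_equalityI) (auto simp: per add.commute[of n])
    also have "\<dots> = map dejean [0 + 3..<38 + 3]"
      by (rule fU) (rule a38)
    also have "[0 + 3..<38 + 3] = [19 * 0 + 3..<19 * 0 + 3 + (38::nat)]"
      by (rule arg_cong2[of _ _ _ _ upt]) simp_all
    also have "map dejean \<dots> = drop 3 (blk 1 0) @ blk 1 1 @ take 3 (blk 1 2)"
      using map_38[OF block_seq_dejean, of 3 0] dejean_small[of 0] dejean_small[of "Suc 0"]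
        dejean_small[of "Suc (Suc 0)"] unfolding H_def by (simp del: upt_rec_numeral)
    finally have 4: "map f [n..<n + 38] = drop 3 (blk 1 0) @ blk 1 1 @ take 3 (blk 1 2)" .
    show ?thesis
      unfolding 1 closing_context_def map_append 2 3 4 by simp
  qed
  let ?W = "\<lambda>i. map f [i..<i + 18]"
  have mid: "middle (map f [s - 38..<s' + 38]) = map f [s - 17..<s' + 17]"
    if "38 \<le> s" "s \<le> s'" for s s'
    using that by (simp add: middle_def take_map drop_map add.commute)
  have wins_mid: "wins 18 (middle (map f [s - 38..<s' + 38])) = map ?W [s - 17..<s']"
    if "38 \<le> s" "s \<le> s'" for s s'
  proof -
    have "wins 18 (map f [s - 17..<s' + 17]) = map ?W [s - 17..<s' + 17 + 1 - 18]"
      by (rule wins_map) (use that in simp)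
    moreover have "s' + 17 + 1 - 18 = s'" by simp
    ultimately show ?thesis by (simp only: mid[OF that])
  qed
  have oW: "wins 18 (middle (opening_context x z y)) = map ?W [a - 17..<b]"
    unfolding open_ctx[symmetric] by (rule wins_mid) (use a38 in \<open>simp_all add: b_def\<close>)
  have cW: "wins 18 (middle (closing_context q t)) = map ?W [c - 17..<n]"
    unfolding close_ctx[symmetric] by (rule wins_mid) (use bc cn in simp_all)
  have o: "fresh factor_trie (map ?W [a - 17..<b])"
    using check_opening_windows xzy unfolding oW[symmetric] list_all_iff by force
  have cl: "fresh (fold insert_word opening_windows factor_trie) (map ?W [c - 17..<n])"
    using check_closing_windows qt unfolding cW[symmetric] list_all_iff by force
  have o_in: "?W i \<in> set opening_windows" if "i \<in> {a - 17..<b}" for i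
  proof -
    have "?W i \<in> set (wins 18 (middle (opening_context x z y)))"
      unfolding oW using that by auto
    then show ?thesis using xzy unfolding opening_windows_def by force
  qed
  have trie_fac: "has_word w factor_trie" if "w \<in> set (factors 18 1) \<union> set (factors 18 2)" for w
    unfolding factor_trie_def using that by (intro has_word_fold) auto
  have win_fac: "has_word (?W i) factor_trie" if "i + 18 \<le> a \<or> b \<le> i \<and> i + 18 \<le> c" for i
    using that
  proof
    assume "i + 18 \<le> a"
    then have "?W i = map dejean [i + 3..<i + 3 + 18]" by (simp add: fU)
    then show ?thesis
      using window_in_factors[OF block_seq_dejean, of 18 "i + 3"] by (intro trie_fac) simp
  next
    assume i: "b \<le> i \<and> i + 18 \<le> c"
    then have "?W i = map e [19 * v + 10 + (i - b)..<19 * v + 10 + (i - b) + 18]"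
      by (simp add: fV)
    then show ?thesis
      using window_in_factors[OF e, of 18 "19 * v + 10 + (i - b)"] by (intro trie_fac) simp
  qed
  have UV: "?W i \<noteq> ?W j" if "i + 18 \<le> a" "b \<le> j" "j + 18 \<le> c" for i j
  proof
    assume eq: "?W i = ?W j"
    have "?W i = map dejean [i + 3..<i + 3 + 18]"
      "?W j = map e [19 * v + 10 + (j - b)..<19 * v + 10 + (j - b) + 18]"
      using that by (simp_all add: fU fV)
    then have "?W i \<in> set (factors 18 1)" "?W i \<in> set (factors 18 2)"
      using window_in_factors[OF block_seq_dejean, of 18 "i + 3"]
        window_in_factors[OF e, of 18 "19 * v + 10 + (j - b)"] eq by simp_all
    then show False
      using avoidsD[OF check_factors] has_word_fold by blast
  qed
  \<comment> \<open>A window equal to one that meets a connector is no factor of \<open>d\<close> or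
    of a translate of \<open>-d\<close>, so it meets a connector too. The closing windows avoid the
    opening ones, and those of one connector are distinct.\<close>
  have Z: "i = j" if ij: "i < n" "j < n" "a < i + 18 \<and> i < b \<or> c < i + 18" "?W i = ?W j" for i j
  proof -
    have not_fac: "\<not> has_word (?W k) factor_trie"
      if "k \<in> {a - 17..<b} \<or> k \<in> {c - 17..<n}" for k
      using that freshD[OF o] freshD[OF cl]
        has_word_fold_mono[of "?W k" factor_trie opening_windows] by auto
    have "i \<in> {a - 17..<b} \<or> i \<in> {c - 17..<n}"
      using ij by auto
    moreover have "\<not> has_word (?W j) factor_trie"
      using not_fac calculation ij(4) by metis
    then have "\<not> (j + 18 \<le> a \<or> b \<le> j \<and> j + 18 \<le> c)"
      using win_fac by blast
    then have "j \<in> {a - 17..<b} \<or> j \<in> {c - 17..<n}"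
      using ij by auto
    moreover have False
      if "k \<in> {a - 17..<b}" "k' \<in> {c - 17..<n}" "?W k = ?W k'" for k k'
    proof -
      have "has_word (?W k') (fold insert_word opening_windows factor_trie)"
        using o_in[OF that(1)] that(3) has_word_fold by metis
      then show False using freshD[OF cl] that(2) by auto
    qed
    moreover note inj_windows[of ?W "a - 17" b i j] inj_windows[of ?W "c - 17" n i j]
    ultimately show ?thesis
      using freshD[OF o] freshD[OF cl] ij(4) by metis
  qed
  have S: "\<not> long_rep f i p l"
    if "a \<le> i + 38" "i + p + (3 * p div 4 + 1) \<le> b + 38" "p < 23" for i p l
  proof (rule short_freeD[OF _ _ that(2,3)])
    show "short_free 23 (map f [a - 38..<b + 38])"
      using check_opening_short xzy unfolding open_ctx list_all_iff by auto
  qed (use that in auto)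
  have T: "\<not> long_rep f i p l"
    if "c \<le> i + 38" "i + p + (3 * p div 4 + 1) \<le> n + 38" "p < 23" for i p l
  proof (rule short_freeD[OF _ _ that(2,3)])
    show "short_free 23 (map f [c - 38..<n + 38])"
      using check_closing_short qt unfolding close_ctx list_all_iff by auto
  qed (use that in auto)
  define w where "w = map g [0..<n]"
  have "\<not> long_rep f i p l" if "i < n" "p + l \<le> n" for i p l
  proof (rule circular_assembly[where a = a and b = b and c = c and n = n])
    show "\<not> long_rep f i p l" if "i + p + l \<le> a" for i p l
      using rU[OF that] block_seq_free[OF block_seq_dejean] by blast
    show "\<not> long_rep f i p l" if "b \<le> i" "i + p + l \<le> c" for i p l
      using rV[OF that] block_seq_free[OF e] by blast
  qed (use a38 bc cn bal that per UV Z S T in \<open>auto simp: b_def\<close>)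
  moreover have "f = (\<lambda>i. w ! (i mod n))"
    using cn by (auto simp: w_def f_def)
  moreover have "kary 3 w"
  proof -
    have "g i < 3" if "i < n" for i
    proof -
      have "t ! (i - c) < 3" if "c \<le> i"
        using that \<open>i < n\<close> n t(2) nth_mem[of "i - c" t] by fastforce
      then show ?thesis by (auto simp: g_def e_def dejean_less not_less)
    qed
    then show ?thesis by (auto simp: kary_def w_def)
  qed
  moreover have "length w = n" by (simp add: w_def)
  ultimately show ?thesis by blast
qed


section \<open>Choosing the positions for every large length\<close>

lemma dejean_in_block: "r < 19 \<Longrightarrow> i = 19 * k + r \<Longrightarrow> dejean i = (dejean k + H ! r) mod 3"
  using dejean_block by simp

text \<open>Take \<open>M\<close> near half of \<open>K\<close> and \<open>m = N + v\<close> with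
  \<open>N = K - M\<close>. Then \<open>dejean m\<close> depends only on \<open>N mod 19\<close>,
  \<open>v\<close> and two adjacent letters of \<open>d\<close>; the finite check gives an offset
  \<open>r\<close> of \<open>M\<close>, determined by \<open>K mod 19\<close>, for which some
  \<open>v\<close> works whatever these letters and \<open>dejean M\<close> are.\<close>

lemma positions_exist:
  assumes "200 \<le> K"
  obtains m M v where "m + M = K + v" "v \<le> 13" "K \<le> 2 * M + 38" "2 * M \<le> K + 36"
    "dejean (Suc v) = (dejean v + 1) mod 3" "dejean (Suc (Suc v)) = (dejean v + 2) mod 3"
    "dejean (M - 1) = (dejean M + 1) mod 3" "dejean (M - 2) = (dejean M + 2) mod 3"
    "(dejean m + dejean v) mod 3 = dejean M"
proof -
  have "K mod 19 \<in> set [0..<19]" by simp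
  then obtain r where r: "r \<in> set [5, 11, 12, 13, 17, 18]"
    and ex: "\<And>x y c. (x, y) \<in> set letter_pairs \<Longrightarrow> c \<in> set [0, 1, 2] \<Longrightarrow>
      \<exists>v\<in>set [0, 1, 5, 6, 7, 13]. ((if (K mod 19 + 19 - r) mod 19 + v < 19
        then x + H ! ((K mod 19 + 19 - r) mod 19 + v)
        else y + H ! ((K mod 19 + 19 - r) mod 19 + v - 19)) + H ! v) mod 3 = c"
    using check_parameters unfolding list_all_iff list_ex_iff Let_def by fast
  have r19: "r < 19" "5 \<le> r" using r by auto
  define M N where "M = 19 * (K div 38) + r" "N = K - M"
  have M: "K \<le> 2 * M + 38" "2 * M \<le> K + 36" "M \<le> K"
    using r19 assms unfolding M_N_def by auto
  define k s where "k = N div 19" "s = N mod 19"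
  have N: "N = 19 * k + s" "s < 19" by (auto simp: k_s_def)
  have s: "s = (K mod 19 + 19 - r) mod 19"
  proof -
    have "K = s + r + (k + K div 38) * 19" using M N by (simp add: M_N_def)
    then have "K mod 19 = (s + r) mod 19" by (metis mod_mult_self1)
    then show ?thesis
      using N(2) r19 by (cases "s + r < 19") (auto simp: le_mod_geq not_less)
  qed
  have "(dejean k, dejean (Suc k)) \<in> set letter_pairs" "dejean M \<in> set [0, 1, 2]"
    using letter_pairs[OF dejean_less dejean_less dejean_Suc] dejean_less[of M]
    by (simp_all add: less_3_iff)
  from ex[OF this, folded s] obtain v where v: "v \<in> set [0, 1, 5, 6, 7, 13]"
    and eq: "((if s + v < 19 then dejean k + H ! (s + v) else dejean (Suc k) + H ! (s + v - 19))
      + H ! v) mod 3 = dejean M" by blast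
  have v19: "v < 19" "v \<le> 13" using v by auto
  have "dejean (N + v) = (if s + v < 19 then dejean k + H ! (s + v)
    else dejean (Suc k) + H ! (s + v - 19)) mod 3"
    using dejean_in_block[of "s + v" "N + v" k] dejean_in_block[of "s + v - 19" "N + v" "Suc k"]
      N v19 by auto
  then have "(dejean (N + v) + dejean v) mod 3 = dejean M"
    using eq dejean_small[OF v19(1)] by (simp add: mod_simps)
  moreover have "N + v + M = K + v" using M by (simp add: M_N_def)
  moreover have "dejean (Suc v) = (dejean v + 1) mod 3" "dejean (Suc (Suc v)) = (dejean v + 2) mod 3"
    using v by (auto simp: dejean_small H_def)
  moreover have "dejean (M - 1) = (dejean M + 1) mod 3" "dejean (M - 2) = (dejean M + 2) mod 3"
  proof -
    let ?k = "K div 38"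
    have "dejean M = (dejean ?k + H ! r) mod 3"
      "dejean (M - 1) = (dejean ?k + H ! (r - 1)) mod 3"
      "dejean (M - 2) = (dejean ?k + H ! (r - 2)) mod 3"
      using r19 by (auto intro!: dejean_in_block simp: M_N_def)
    moreover have "H ! (r - 1) mod 3 = (H ! r + 1) mod 3" "H ! (r - 2) mod 3 = (H ! r + 2) mod 3"
      using r by (auto simp: H_def)
    ultimately show "dejean (M - 1) = (dejean M + 1) mod 3" "dejean (M - 2) = (dejean M + 2) mod 3"
      by (metis mod_add_left_eq mod_add_right_eq add.assoc)+
  qed
  ultimately show ?thesis using that M v19 by blast
qed

text \<open>Both \<open>m\<close> and \<open>M\<close> stay within a bounded distance of half of
  \<open>K\<close>, so for \<open>K \<ge> 200\<close> the lengths of \<open>U\<close> and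
  \<open>V\<close> are within the ratio 6.\<close>

lemma balanced_lengths:
  fixes L v M q m K t :: nat
  assumes "9 \<le> q" "q \<le> 16" "L + 19 * v + 10 = 19 * M + q" "m + M = K + v" "v \<le> 13"
    "K \<le> 2 * M + 38" "2 * M \<le> K + 36" "200 \<le> K"
  shows "19 * m + 6 \<le> 6 * (1 + L + t)" "L \<le> 6 * (19 * m + 6 + 1 + t)"
  using assms unfolding distrib_left by linarith+

lemma circular_words_exist:
  assumes "10000 \<le> n"
  shows "\<exists>w. length w = n \<and> kary 3 w \<and>
    (\<forall>i p l. i < n \<longrightarrow> p + l \<le> n \<longrightarrow> \<not> long_rep (\<lambda>i. w ! (i mod n)) i p l)"
proof -
  obtain q t where qt: "closings ! (n mod 19) = (q, t)" by fastforce
  have l: "length closings = 19" by (simp add: closings_def)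
  then have in_set: "(q, t) \<in> set closings" using qt by (metis mod_less_divisor nth_mem zero_less_numeral)
  have "zip [0..<19] closings ! (n mod 19) = (n mod 19, q, t)"
    using l qt by simp
  moreover have "n mod 19 < length (zip [0..<19] closings)" using l by simp
  ultimately have "(n mod 19, q, t) \<in> set (zip [0..<19] closings)" by (metis nth_mem)
  then have t: "(q + length t) mod 19 = (n mod 19 + 3) mod 19" "length t < 70" "q = 9 \<or> q = 16"
    using check_closings by (auto simp: list_all_iff)
  define K where "K = (n + 3 - q - length t) div 19"
  have K: "n + 3 = 19 * K + q + length t"
  proof -
    have "(q + length t) mod 19 = (n + 3) mod 19" using t(1) by (simp add: mod_simps)
    moreover have "q + length t \<le> n + 3" using t assms by auto
    ultimately have "19 dvd (n + 3) - (q + length t)"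
      by (metis mod_eq_dvd_iff_nat)
    then have "19 * K = n + 3 - (q + length t)" by (simp add: K_def)
    then show ?thesis using \<open>q + length t \<le> n + 3\<close> by simp
  qed
  have "200 \<le> K" using K t assms by auto
  then obtain m M v where *: "m + M = K + v" "v \<le> 13" "K \<le> 2 * M + 38" "2 * M \<le> K + 36"
    "dejean (Suc v) = (dejean v + 1) mod 3" "dejean (Suc (Suc v)) = (dejean v + 2) mod 3"
    "dejean (M - 1) = (dejean M + 1) mod 3" "dejean (M - 2) = (dejean M + 2) mod 3"
    "(dejean m + dejean v) mod 3 = dejean M"
    by (rule positions_exist)
  define a c where "a = 19 * m + 6" "c = a + 19 * M + q - (19 * v + 9)"
  have c: "c + 19 * v + 9 = a + 19 * M + q"
    using * \<open>200 \<le> K\<close> unfolding a_c_def by auto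
  show ?thesis
  proof (rule circular_construction[OF _ _ in_set *(5-9)])
    show "2 \<le> m" "v + 3 \<le> M" using * \<open>200 \<le> K\<close> by auto
    show "n = c + length t" using c K *(1) by (simp add: a_c_def(1))
    define L where "L = c - (a + 1)"
    have L: "L + 19 * v + 10 = 19 * M + q"
      using c *(1-4) \<open>200 \<le> K\<close> a_c_def(1) unfolding L_def by linarith
    then have "c = a + 1 + L" using c by simp
    then have n: "n = 19 * m + 7 + L + length t" and "a = 19 * m + 6"
      using \<open>n = c + length t\<close> by (auto simp: a_c_def(1))
    have "9 \<le> q" "q \<le> 16" using t(3) by auto
    then have "a \<le> 6 * (1 + L + length t)" "L \<le> 6 * (a + 1 + length t)"
      using balanced_lengths[OF _ _ L *(1-4) \<open>200 \<le> K\<close>] \<open>a = 19 * m + 6\<close> by auto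
    moreover have "n - a = 1 + L + length t" "n - L = a + 1 + length t"
      using n \<open>a = 19 * m + 6\<close> by simp_all
    ultimately show "a \<le> 6 * (n - a)" "c - (a + 1) \<le> 6 * (n - (c - (a + 1)))"
      unfolding L_def[symmetric] by simp_all
  qed (use c in \<open>auto simp: a_c_def(1)\<close>)
qed


section \<open>From repetitions to exponents\<close>

lemma has_period_length: "w \<noteq> [] \<Longrightarrow> has_period w (length w)"
  by (auto simp: has_period_def Suc_le_eq)

text \<open>For a factor of length \<open>p + l\<close> with minimal period \<open>p\<close>,
  exponent above 7/4 means \<open>3 * p < 4 * l\<close>. A conjugate is a rotation, so its factors
  are stretches of at most \<open>length w\<close> cyclic positions of \<open>w\<close>.\<close>

lemma free_circularI:
  assumes free: "\<And>i p l. i < length w \<Longrightarrow> p + l \<le> length w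
      \<Longrightarrow> \<not> long_rep (\<lambda>i. w ! (i mod length w)) i p l"
    and \<beta>: "7 / 4 < \<beta>"
  shows "free_circular \<beta> (circular_word w)"
  unfolding free_circular_def
proof
  assume "\<exists>u. u \<noteq> [] \<and> circular_factor u (circular_word w) \<and> \<beta> \<le> exponent u"
  then obtain u x where u: "u \<noteq> []" "\<beta> \<le> exponent u" and "conjugate w x" "sublist u x"
    unfolding circular_factor_def circular_word_def by blast
  then obtain a b ps ss where w: "w = a @ b" and x: "b @ a = ps @ u @ ss"
    unfolding conjugate_def sublist_def by blast
  define n i where "n = length w" "i = (length a + length ps) mod n"
  define p where "p = min_period u"
  have len: "length ps + length u + length ss = n"
    using arg_cong[OF x, of length] by (simp add: n_i_def w)
  then have n: "0 < n" using u by auto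
  have u_nth: "u ! j = w ! ((i + j) mod n)" if "j < length u" for j
  proof -
    have "u ! j = (b @ a) ! (length ps + j)"
      using that by (simp add: x nth_append)
    also have "b @ a = rotate (length a) w"
      by (simp add: w rotate_append)
    also have "\<dots> ! (length ps + j) = w ! ((length a + (length ps + j)) mod n)"
      using that len by (simp add: nth_rotate n_i_def)
    finally show ?thesis
      by (simp add: n_i_def mod_simps add.assoc)
  qed
  have per: "has_period u p"
    unfolding p_def min_period_def using has_period_length[OF u(1)] by (rule LeastI)
  have "p \<le> length u"
    unfolding p_def min_period_def using has_period_length[OF u(1)] by (rule Least_le)
  then obtain l where l: "length u = p + l" using le_Suc_ex by blast
  have p: "0 < p" using per by (simp add: has_period_def)
  have "7 / 4 < real (length u) / real p"
    using u(2) \<beta> unfolding exponent_def p_def by linarith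
  then have "3 * p < 4 * l" using p by (simp add: l field_simps)
  moreover have "w ! ((i + j) mod n) = w ! ((i + p + j) mod n)" if "j < l" for j
  proof -
    have "u ! (j + p) = u ! j" using per that l by (simp add: has_period_def)
    then show ?thesis using u_nth[of j] u_nth[of "j + p"] that l by (simp add: add_ac)
  qed
  ultimately have "long_rep (\<lambda>i. w ! (i mod length w)) i p l"
    using p by (auto simp: long_rep_def n_i_def)
  moreover have "i < length w" "p + l \<le> length w"
    using n len l by (auto simp: n_i_def)
  ultimately show False using free by blast
qed

section \<open>The lower bound\<close>

text \<open>In a search that extends words at the front, a new repetition must be a prefix.\<close>

fun starts_rep :: "(nat \<times> nat) list \<Rightarrow> nat list \<Rightarrow> bool"
  and starts_rep_aux :: "bool \<Rightarrow> (nat \<times> nat) list \<Rightarrow> nat list \<Rightarrow> bool" where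
  "starts_rep [] w = False"
| "starts_rep ((l, p) # ps) w = starts_rep_aux (agree l w (drop p w)) ps w"
| "starts_rep_aux True ps w = True"
| "starts_rep_aux False ps w = starts_rep ps w"

lemma starts_repD: "starts_rep ps w \<Longrightarrow> \<exists>(l, p)\<in>set ps. agree l w (drop p w)"
proof (induction ps)
  case (Cons a ps)
  then show ?case by (cases a; cases "agree (fst a) w (drop (snd a) w)") auto
qed auto

fun both :: "bool \<Rightarrow> bool \<Rightarrow> bool" where
  "both True b = b"
| "both False b = False"

lemma both_iff: "both a b \<longleftrightarrow> a \<and> b"
  by (cases a) auto

text \<open>Backtracking over words that are extended to the left.\<close>

fun unavoidable :: "(nat \<times> nat) list \<Rightarrow> nat \<Rightarrow> nat list \<Rightarrow> bool"
  and unavoidable_aux :: "bool \<Rightarrow> (nat \<times> nat) list \<Rightarrow> nat \<Rightarrow> nat list \<Rightarrow> bool" where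
  "unavoidable ps k w = unavoidable_aux (starts_rep ps w) ps k w"
| "unavoidable_aux True ps k w = True"
| "unavoidable_aux False ps 0 w = False"
| "unavoidable_aux False ps (Suc k) w = both (unavoidable ps k (0 # w))
     (both (unavoidable ps k (1 # w)) (unavoidable ps k (2 # w)))"

declare unavoidable.simps(1) [simp del]

lemma unavoidableD:
  assumes "unavoidable ps k w" "length v = k" "set v \<subseteq> {..<3}"
  shows "\<exists>j. starts_rep ps (drop j (v @ w))"
  using assms
proof (induction k arbitrary: v w)
  case 0
  then show ?case
    by (cases "starts_rep ps w") (auto simp: unavoidable.simps intro: exI[of _ 0])
next
  case (Suc k)
  show ?case
  proof (cases "starts_rep ps w")
    case True
    then show ?thesis by (intro exI[of _ "length v"]) simp
  next
    case False
    obtain v' x where v: "v = v' @ [x]" using Suc.prems(2) by (metis length_Suc_conv_rev)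
    then have "x < 3" using Suc.prems(3) by simp
    then have "unavoidable ps k (x # w)"
      using Suc.prems(1) False unfolding less_3_iff
      by (auto simp: unavoidable.simps(1)[of ps "Suc k"] both_iff)
    then have "\<exists>j. starts_rep ps (drop j (v' @ x # w))"
      using Suc.prems(2,3) v by (intro Suc.IH) auto
    then show ?thesis by (simp add: v)
  qed
qed

text \<open>\<open>(3 * p + 3) div 4\<close> is three quarters of \<open>p\<close> rounded up, the
  least \<open>l\<close> for which \<open>p + l\<close> is at least 7/4 of \<open>p\<close>; periods
  up to 21 close every branch.\<close>

lemma check_unavoidable:
  "unavoidable (map (\<lambda>p. ((3 * p + 3) div 4, p)) [1..<22]) 39 []"
  by code_simp

lemma free_word_bound:
  assumes "free_word \<beta> w" "kary 3 w" "39 \<le> length w"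
  shows "7 / 4 \<le> \<beta>"
proof (rule ccontr)
  assume \<beta>: "\<not> ?thesis"
  define v where "v = take 39 w"
  have "length v = 39" "set v \<subseteq> {..<3}"
    using assms(2,3) set_take_subset[of 39 w] by (auto simp: v_def kary_def)
  from unavoidableD[OF check_unavoidable this] obtain j
    where "starts_rep (map (\<lambda>p. ((3 * p + 3) div 4, p)) [1..<22]) (drop j v)" by auto
  from starts_repD[OF this] obtain p where p: "0 < p"
    and ag: "agree ((3 * p + 3) div 4) (drop j v) (drop p (drop j v))"
    by (auto simp: Suc_le_eq simp del: drop_drop)
  define l where "l = (3 * p + 3) div 4"
  have l: "3 * p \<le> 4 * l" by (simp add: l_def)
  define u where "u = take (p + l) (drop j v)"
  have len: "length u = p + l"
    using ag unfolding l_def[symmetric] u_def agree_iff using p l by auto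
  have "has_period u p"
    using ag p len unfolding l_def[symmetric] agree_iff has_period_def u_def
    by (auto simp: add_ac)
  then have "min_period u \<le> p" "has_period u (min_period u)"
    unfolding min_period_def by (rule Least_le, rule LeastI)
  then have mp: "0 < min_period u" "min_period u \<le> p" by (auto simp: has_period_def)
  have "7 / 4 \<le> real (p + l) / real p"
    using l p by (simp add: field_simps)
  \<comment> \<open>The minimal period may be smaller than \<open>p\<close>, which only raises the
    exponent.\<close>
  also have "\<dots> \<le> exponent u"
    unfolding exponent_def len using mp by (intro divide_left_mono) auto
  finally have "\<beta> \<le> exponent u" using \<beta> by simp
  moreover have "u \<noteq> []" using len p by auto
  moreover have "sublist u w"
  proof -
    have "sublist u v" unfolding u_def
      by (meson sublist_order.order.trans sublist_take sublist_drop)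
    then show ?thesis unfolding v_def by (meson sublist_order.order.trans sublist_take)
  qed
  ultimately show False using assms(1) by (auto simp: free_word_def)
qed

lemma free_word_if_free_circular: "free_circular \<beta> (circular_word w) \<Longrightarrow> free_word \<beta> w"
proof -
  have "conjugate w w" unfolding conjugate_def by (metis append_Nil append_Nil2)
  then show "free_circular \<beta> (circular_word w) \<Longrightarrow> free_word \<beta> w"
    by (auto simp: free_circular_def free_word_def circular_factor_def circular_word_def)
qed

theorem mainTheorem2:
  shows "CRT_I 3 = CRT_W 3 \<and> CRT_W 3 = RT 3 \<and> RT 3 = ereal (7 / 4)"
proof -
  have lower: "ereal (7 / 4) \<le> RT 3"
    unfolding RT_def
  proof (rule Inf_greatest, elim imageE CollectE)
    fix x \<beta> assume x: "x = ereal \<beta>" and "\<forall>n. \<exists>w. n \<le> length w \<and> kary 3 w \<and> free_word \<beta> w"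
    then obtain w where "39 \<le> length w" "kary 3 w" "free_word \<beta> w" by blast
    then show "ereal (7 / 4) \<le> x" using free_word_bound unfolding x by simp
  qed
  have RT_W: "RT 3 \<le> CRT_W 3"
    unfolding RT_def CRT_W_def
    by (intro Inf_superset_mono image_mono) (blast intro: free_word_if_free_circular)
  have W_I: "CRT_W 3 \<le> CRT_I 3"
    unfolding CRT_W_def CRT_I_def
  proof (intro Inf_superset_mono image_mono subsetI CollectI allI)
    fix \<beta> :: real and n :: nat
    assume "\<beta> \<in> {\<beta>. \<exists>N. \<forall>n\<ge>N. \<exists>w. length w = n \<and> kary 3 w \<and> free_circular \<beta> (circular_word w)}"
    then obtain N where "\<forall>n\<ge>N. \<exists>w. length w = n \<and> kary 3 w \<and> free_circular \<beta> (circular_word w)"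
      by blast
    from this[rule_format, of "max n N"]
    show "\<exists>w. n \<le> length w \<and> kary 3 w \<and> free_circular \<beta> (circular_word w)"
      by (metis max.cobounded1 max.cobounded2)
  qed
  \<comment> \<open>The circular words may contain exponent exactly 7/4, so the bound is obtained
    for each larger \<beta> and then in the limit.\<close>
  have upper: "CRT_I 3 \<le> ereal \<beta>" if "7 / 4 < \<beta>" for \<beta> :: real
    unfolding CRT_I_def
  proof (rule Inf_lower, rule imageI, rule CollectI, intro exI[of _ 10000] allI impI)
    fix n :: nat assume "10000 \<le> n"
    then obtain w where "length w = n" "kary 3 w"
      "\<And>i p l. i < n \<Longrightarrow> p + l \<le> n \<Longrightarrow> \<not> long_rep (\<lambda>i. w ! (i mod n)) i p l"
      using circular_words_exist[of n] by blast
    then show "\<exists>w. length w = n \<and> kary 3 w \<and> free_circular \<beta> (circular_word w)"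
      using free_circularI[of w, OF _ that] by blast
  qed
  have "CRT_I 3 \<le> ereal (7 / 4) + ereal e" if "0 < e" for e
    using upper[of "7 / 4 + e"] that by simp
  then have "CRT_I 3 \<le> ereal (7 / 4)"
    by (rule ereal_le_epsilon2)
  with lower RT_W W_I show ?thesis by auto
qed

end
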